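(* Let $x_0\in\mathbb{R}^d$ be any strictly feasible point, i.e. $f_i(x_0)<0$ for all $i\in\{1,\dots,m\}$. Let $L_{\max}=\max_{1\le i\le m}L_i$, $$l_0^*=\min_{i\in\{1,\dots,m\}}\frac{-f_i(x_0)}{L_{\max}},\qquad \nu_0^*=\frac{l_0^*}{\sqrt d},$$ and for $i\in\{1,\dots,m\}$ define $$\mathcal{S}^{(0)}_i(x_0)=\Big\{x\in\mathbb{R}^d:\ f_i(x_0)+\nabla^{\nu_0^*}f_i(x_0)^\top(x-x_0)+2M_i\|x-x_0\|^2\le 0\Big\},\qquad \mathcal{S}^{(0)}(x_0)=\bigcap_{i=1}^m\mathcal{S}^{(0)}_i(x_0).$$ Then: (i) all the samples needed for computing $\nabla^{\nu_0^*}f_i(x_0)$, namely $x_0$ and $x_0+\nu_0^*e_j$ for $j=1,\dots,d$, belong to $\Omega$; (ii) $x_0\in\mathcal{S}^{(0)}(x_0)$, so this set is non-empty; (iii) every $x\in\mathcal{S}^{(0)}(x_0)$ is strictly feasible, i.e. $f_i(x)<0$ for all $i\in\{1,\dots,m\}$.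
   Context: Let $d,m\ge 1$, let $f_0,f_1,\dots,f_m:\mathbb{R}^d\to\mathbb{R}$ be continuously differentiable, and let $\Omega=\{x\in\mathbb{R}^d: f_i(x)\le 0,\ i=1,\dots,m\}$ be the feasible set of $\min_{x\in\Omega}f_0(x)$. $\|\cdot\|$ is the Euclidean norm and $e_j$ is the $j$-th standard basis vector. Smoothness assumption: there are constants $L_i,M_i>0$ ($i=0,\dots,m$) and a set $\overline\Omega\supset\Omega$ such that for all $x_1,x_2\in\overline\Omega$: $|f_i(x_1)-f_i(x_2)|\le L_i\|x_1-x_2\|$ and $\|\nabla f_i(x_1)-\nabla f_i(x_2)\|\le M_i\|x_1-x_2\|$. Moreover $L_i>L_{i,\inf}$ and $M_i>M_{i,\inf}$, where $L_{i,\inf}$ (resp. $M_{i,\inf}$) is the infimum of the constants for which the first (resp. second) inequality holds for all $x_1,x_2\in\Omega$. Finite-difference gradient estimate: for $\nu>0$, $\nabla^{\nu}f_i(x)=\sum_{j=1}^d\frac{f_i(x+\nu e_j)-f_i(x)}{\nu}e_j$. *)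

theory Defs
  imports "HOL-Analysis.Analysis"
begin

text \<open>
  The dimension \<open>d\<close> is the cardinality of the index type \<open>'n\<close>. The problem
  functions are a family \<open>f :: nat \<Rightarrow> real ^ 'n \<Rightarrow> real\<close>, where \<open>f 0\<close> is the objective
  and \<open>f 1, \<dots>, f m\<close> are the constraint functions.
\<close>

definition gradient :: "(real ^ 'n \<Rightarrow> real) \<Rightarrow> real ^ 'n \<Rightarrow> real ^ 'n" where
  "gradient g x = (THE D. GDERIV g x :> D)"

lemma gradient_eqI:
  assumes "GDERIV g x :> D"
  shows "gradient g x = D"
  unfolding gradient_def
proof (rule the_equality)
  fix D' assume "GDERIV g x :> D'"
  then have "(\<lambda>h. inner h D') = (\<lambda>h. inner h D)"
    using assms unfolding gderiv_def by (rule has_derivative_unique)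
  then have "\<forall>h. inner h D' = inner h D"
    by (simp add: fun_eq_iff)
  then show "D' = D"
    by (simp only: vector_eq_ldot)
qed (fact assms)

lemma gradient_GDERIV:
  assumes "g differentiable at x"
  shows "GDERIV g x :> gradient g x"
proof -
  obtain g' where g': "(g has_derivative g') (at x)"
    using assms unfolding differentiable_def by blast
  then interpret linear g'
    by (rule has_derivative_linear)
  have "g' h = inner h (\<chi> j. g' (axis j 1))" for h
  proof -
    have "g' h = g' (\<Sum>j\<in>UNIV. h $ j *\<^sub>R axis j 1)"
      using basis_expansion[of h] by (simp only: scalar_mult_eq_scaleR)
    also have "\<dots> = (\<Sum>j\<in>UNIV. h $ j * g' (axis j 1))"
      by (simp add: sum scale)
    finally show ?thesis
      by (simp add: inner_vec_def)
  qed
  then have "g' = (\<lambda>h. inner h (\<chi> j. g' (axis j 1)))"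
    by (rule ext)
  with g' have "GDERIV g x :> (\<chi> j. g' (axis j 1))"
    unfolding gderiv_def by (rule back_subst)
  then show ?thesis
    by (simp add: gradient_eqI)
qed

definition continuously_differentiable :: "(real ^ 'n \<Rightarrow> real) \<Rightarrow> bool" where
  "continuously_differentiable g \<longleftrightarrow>
     (\<forall>x. g differentiable at x) \<and> continuous_on UNIV (gradient g)"

definition feasible_set :: "nat \<Rightarrow> (nat \<Rightarrow> real ^ 'n \<Rightarrow> real) \<Rightarrow> (real ^ 'n) set" where
  "feasible_set m f = {x. \<forall>i\<in>{1..m}. f i x \<le> 0}"

definition strictly_feasible :: "nat \<Rightarrow> (nat \<Rightarrow> real ^ 'n \<Rightarrow> real) \<Rightarrow> real ^ 'n \<Rightarrow> bool" where
  "strictly_feasible m f x \<longleftrightarrow> (\<forall>i\<in>{1..m}. f i x < 0)"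

text \<open>
  The constants range over nonnegative reals here, because \<open>lipschitz_on\<close> includes \<open>0 \<le> K\<close>.
  The value is meaningful only if some Lipschitz constant exists, since
  \<open>Inf {}\<close> is unspecified on the reals.
\<close>

definition lipschitz_inf :: "'a::metric_space set \<Rightarrow> ('a \<Rightarrow> 'b::metric_space) \<Rightarrow> real" where
  "lipschitz_inf S g = Inf {K. K-lipschitz_on S g}"

definition fd_gradient :: "real \<Rightarrow> (real ^ 'n \<Rightarrow> real) \<Rightarrow> real ^ 'n \<Rightarrow> real ^ 'n" where
  "fd_gradient \<nu> g x =
     (\<Sum>j\<in>UNIV. ((g (x + \<nu> *\<^sub>R axis j 1) - g x) / \<nu>) *\<^sub>R axis j 1)"

definition L_max :: "nat \<Rightarrow> (nat \<Rightarrow> real) \<Rightarrow> real" where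
  "L_max m L = Max (L ` {1..m})"

definition l0_star ::
    "nat \<Rightarrow> (nat \<Rightarrow> real ^ 'n \<Rightarrow> real) \<Rightarrow> (nat \<Rightarrow> real) \<Rightarrow> real ^ 'n \<Rightarrow> real" where
  "l0_star m f L x0 = Min ((\<lambda>i. - f i x0 / L_max m L) ` {1..m})"

definition nu0_star ::
    "nat \<Rightarrow> (nat \<Rightarrow> real ^ 'n \<Rightarrow> real) \<Rightarrow> (nat \<Rightarrow> real) \<Rightarrow> real ^ 'n \<Rightarrow> real" where
  "nu0_star m f L x0 = l0_star m f L x0 / sqrt (real CARD('n))"

definition local_set_i ::
    "nat \<Rightarrow> (nat \<Rightarrow> real ^ 'n \<Rightarrow> real) \<Rightarrow> (nat \<Rightarrow> real) \<Rightarrow> (nat \<Rightarrow> real) \<Rightarrow> real ^ 'n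
       \<Rightarrow> nat \<Rightarrow> (real ^ 'n) set" where
  "local_set_i m f L M x0 i =
     {x. f i x0 + fd_gradient (nu0_star m f L x0) (f i) x0 \<bullet> (x - x0)
           + 2 * M i * (norm (x - x0))\<^sup>2 \<le> 0}"

definition local_set ::
    "nat \<Rightarrow> (nat \<Rightarrow> real ^ 'n \<Rightarrow> real) \<Rightarrow> (nat \<Rightarrow> real) \<Rightarrow> (nat \<Rightarrow> real) \<Rightarrow> real ^ 'n
       \<Rightarrow> (real ^ 'n) set" where
  "local_set m f L M x0 = (\<Inter>i\<in>{1..m}. local_set_i m f L M x0 i)"

end

theory Submission
  imports Defs
begin

text \<open>
  On the segment from the strictly feasible point \<open>x0\<close> to \<open>x\<close>, the Lipschitz bounds are available
  only as long as the segment has not left the feasible set. Hence each estimate has to yield strict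
  feasibility from feasibility of the part already traversed; a first exit point then cannot
  exist. Within distance \<open>l0_star\<close> of \<open>x0\<close>, Lipschitz continuity of the constraints suffices.
  For \<open>r = norm (x - x0)\<close> at least \<open>l0_star\<close>, the finite-difference error is at most
  \<open>M i * l0_star / 2 \<le> M i * r / 2\<close>, so at time \<open>t\<close> the quadratic upper bound gives
  at most \<open>(1 - t) * f i x0 - t * M i * r\<^sup>2 < 0\<close>.
\<close>

section \<open>First-exit arguments along segments\<close>

lemma first_exit_argument:
  fixes g :: "'i \<Rightarrow> real \<Rightarrow> real"
  assumes I: "finite I"
    and cont: "\<And>i. i \<in> I \<Longrightarrow> continuous_on {0..1} (g i)"
    and start: "\<And>i. i \<in> I \<Longrightarrow> g i 0 < 0"
    and step: "\<And>t i. \<lbrakk>t \<in> {0..1}; i \<in> I; \<And>s j. \<lbrakk>s \<in> {0..t}; j \<in> I\<rbrakk> \<Longrightarrow> g j s \<le> 0\<rbrakk> \<Longrightarrow> g i t < 0"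
    and "i \<in> I" "t \<in> {0..1}"
  shows "g i t < 0"
proof (rule ccontr)
  assume "\<not> g i t < 0"
  \<comment> \<open>\<open>B\<close> collects the times at which some \<open>g i\<close> is
    nonnegative. It is compact because \<open>I\<close> is finite, so a least such time
    \<open>u\<close> exists: the first exit.\<close>
  define B where "B = (\<Union>i\<in>I. {0..1} \<inter> g i -` {0..})"
  have "B \<noteq> {}"
    using assms(5,6) \<open>\<not> g i t < 0\<close> unfolding B_def by force
  moreover have "compact B"
  proof -
    have "closed B"
      unfolding B_def using I cont
      by (intro closed_UN ballI continuous_closed_preimage) auto
    moreover have "bounded B"
      unfolding B_def by (rule bounded_subset[of "{0..1::real}"]) auto
    ultimately show ?thesis
      by (simp add: compact_eq_bounded_closed)
  qed
  ultimately obtain u where u: "u \<in> B" "\<And>s. s \<in> B \<Longrightarrow> u \<le> s"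
    using compact_attains_inf[of B] by blast
  then have u01: "u \<in> {0..1}"
    by (auto simp: B_def)
  obtain k where k: "k \<in> I" "g k u \<ge> 0"
    using u(1) by (auto simp: B_def)
  then have "u > 0"
    using start u01 by (cases "u = 0") force+
  have before: "g j s < 0" if "s \<in> {0..<u}" "j \<in> I" for j s
    using u(2)[of s] that u01 by (force simp: B_def)
  \<comment> \<open>\<open>step\<close> asks for the closed interval, but minimality of
    \<open>u\<close> controls only earlier times. Continuity carries the non-strict bound to
    \<open>u\<close> itself; \<open>u > 0\<close> makes \<open>{0..<u}\<close> dense in
    \<open>{0..u}\<close>.\<close>
  have "g j s \<le> 0" if "s \<in> {0..u}" "j \<in> I" for j s
  proof -
    have "continuous_on {0..u} (g j)"
      using cont[OF \<open>j \<in> I\<close>] u01 by (auto intro: continuous_on_subset)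
    moreover have "closure {0..<u} = {0..u}"
      using \<open>u > 0\<close> by simp
    ultimately show ?thesis
      using continuous_le_on_closure[of "{0..<u}" "g j" s 0] before that by (simp add: less_imp_le)
  qed
  then show False
    using step[OF u01 k(1)] k(2) by fastforce
qed

text \<open>The feasible set may be nonconvex, so the segment from \<open>x0\<close> to
  \<open>x\<close> cannot be assumed to lie in it. An estimate at a point may instead presuppose
  feasibility of the segment up to and including that point.\<close>

lemma segment_strictly_feasible:
  fixes f :: "nat \<Rightarrow> real ^ 'n \<Rightarrow> real"
  assumes cont: "\<And>i. i \<in> {1..m} \<Longrightarrow> continuous_on UNIV (f i)"
    and x0: "strictly_feasible m f x0"
    and step: "\<And>t i. \<lbrakk>t \<in> {0..1}; i \<in> {1..m};
        closed_segment x0 (x0 + t *\<^sub>R (x - x0)) \<subseteq> feasible_set m f\<rbrakk>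
        \<Longrightarrow> f i (x0 + t *\<^sub>R (x - x0)) < 0"
  shows "strictly_feasible m f x"
  unfolding strictly_feasible_def
proof
  fix i assume i: "i \<in> {1..m}"
  define g where "g i t = f i (x0 + t *\<^sub>R (x - x0))" for i t
  have "g i 1 < 0"
  proof (rule first_exit_argument[of "{1..m}" g])
    fix i assume "i \<in> {1..m}"
    then show "continuous_on {0..1} (g i)"
      unfolding g_def by (intro continuous_on_compose2[OF cont] continuous_intros) auto
  next
    fix t i
    assume t: "t \<in> {0..1}" "i \<in> {1..m}"
      and le: "\<And>s j. \<lbrakk>s \<in> {0..t}; j \<in> {1..m}\<rbrakk> \<Longrightarrow> g j s \<le> 0"
    have "closed_segment x0 (x0 + t *\<^sub>R (x - x0)) \<subseteq> feasible_set m f"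
    proof
      fix y assume "y \<in> closed_segment x0 (x0 + t *\<^sub>R (x - x0))"
      then obtain u where u: "0 \<le> u" "u \<le> 1" "y = x0 + (u * t) *\<^sub>R (x - x0)"
        by (auto simp: in_segment algebra_simps)
      then have "u * t \<in> {0..t}"
        using t by (auto simp: mult_left_le_one_le)
      with le show "y \<in> feasible_set m f"
        by (auto simp: feasible_set_def g_def u(3))
    qed
    then show "g i t < 0"
      using step t by (simp add: g_def)
  qed (use i x0 in \<open>auto simp: g_def strictly_feasible_def\<close>)
  then show "f i x < 0"
    by (simp add: g_def)
qed

section \<open>First-order Taylor remainders and the finite-difference error\<close>

lemma descent_lemma_upper:
  fixes g :: "'a::real_inner \<Rightarrow> real"
  assumes G: "\<And>z. z \<in> closed_segment x y \<Longrightarrow> GDERIV g z :> G z"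
    and lip: "\<And>z. z \<in> closed_segment x y \<Longrightarrow> norm (G z - G x) \<le> M * norm (z - x)"
  shows "g y - g x - G x \<bullet> (y - x) \<le> M / 2 * (norm (y - x))\<^sup>2"
proof -
  define v where "v = y - x"
  \<comment> \<open>The quadratic term is the antiderivative of
    \<open>M * t * (norm v)\<^sup>2\<close>, which bounds the growth of the slope along the segment.
    Hence \<open>\<phi>\<close> is nonincreasing, and comparing times 0 and 1 gives the factor
    \<open>M / 2\<close>.\<close>
  define \<phi> where "\<phi> t = g (x + t *\<^sub>R v) - t * (G x \<bullet> v) - M / 2 * t\<^sup>2 * (norm v)\<^sup>2" for t
  have "\<phi> 1 \<le> \<phi> 0"
  proof (rule DERIV_nonpos_imp_nonincreasing, simp, intro exI conjI)
    fix t :: real assume t: "0 \<le> t" "t \<le> 1"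
    let ?z = "x + t *\<^sub>R v"
    have z: "?z \<in> closed_segment x y"
      using t by (auto simp: in_segment v_def algebra_simps)
    have "(g has_derivative (\<lambda>h. h \<bullet> G ?z)) (at ?z)"
      using G[OF z] by (simp add: gderiv_def)
    moreover have "((\<lambda>t. x + t *\<^sub>R v) has_derivative (\<lambda>h. h *\<^sub>R v)) (at t)"
      by (auto intro!: derivative_eq_intros)
    ultimately have "((\<lambda>t. g (x + t *\<^sub>R v)) has_derivative (\<lambda>h. (h *\<^sub>R v) \<bullet> G ?z)) (at t)"
      by (rule has_derivative_compose[rotated])
    then have "((\<lambda>t. g (x + t *\<^sub>R v)) has_real_derivative v \<bullet> G ?z) (at t)"
      by (rule has_derivative_imp_has_field_derivative) simp
    then show "(\<phi> has_real_derivative v \<bullet> G ?z - G x \<bullet> v - M * t * (norm v)\<^sup>2) (at t)"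
      unfolding \<phi>_def by (auto intro!: derivative_eq_intros)
    have "v \<bullet> G ?z - G x \<bullet> v = (G ?z - G x) \<bullet> v"
      by (simp add: inner_commute algebra_simps)
    also have "\<dots> \<le> norm (G ?z - G x) * norm v"
      by (rule norm_cauchy_schwarz)
    also have "\<dots> \<le> (M * norm (?z - x)) * norm v"
      by (rule mult_right_mono[OF lip[OF z]]) simp
    also have "\<dots> = M * t * (norm v)\<^sup>2"
      using t by (simp add: power2_eq_square)
    finally show "v \<bullet> G ?z - G x \<bullet> v - M * t * (norm v)\<^sup>2 \<le> 0"
      by simp
  qed
  then show ?thesis
    by (simp add: \<phi>_def v_def)
qed

text \<open>The lower bound is the upper bound for \<open>- g\<close>, whose gradient
  \<open>- G\<close> varies at the same rate.\<close>

lemma descent_lemma: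
  fixes g :: "'a::real_inner \<Rightarrow> real"
  assumes G: "\<And>z. z \<in> closed_segment x y \<Longrightarrow> GDERIV g z :> G z"
    and lip: "\<And>z. z \<in> closed_segment x y \<Longrightarrow> norm (G z - G x) \<le> M * norm (z - x)"
  shows "\<bar>g y - g x - G x \<bullet> (y - x)\<bar> \<le> M / 2 * (norm (y - x))\<^sup>2"
proof -
  have "(- g y) - (- g x) - (- G x) \<bullet> (y - x) \<le> M / 2 * (norm (y - x))\<^sup>2"
  proof (rule descent_lemma_upper[of x y "\<lambda>z. - g z" "\<lambda>z. - G z"])
    fix z assume z: "z \<in> closed_segment x y"
    show "GDERIV (\<lambda>z. - g z) z :> - G z"
      using G[OF z] by (rule GDERIV_minus)
    show "norm (- G z - - G x) \<le> M * norm (z - x)"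
      using lip[OF z] by (simp add: norm_minus_commute)
  qed
  with descent_lemma_upper[of x y g G, OF G lip] show ?thesis
    unfolding abs_le_iff by (simp add: inner_minus_left)
qed

lemma fd_gradient_nth: "fd_gradient \<nu> g x $ j = (g (x + \<nu> *\<^sub>R axis j 1) - g x) / \<nu>"
  by (simp add: fd_gradient_def axis_def if_distrib cong: if_cong)

text \<open>Each coordinate of the error is a Taylor remainder over a step of length
  \<open>\<nu>\<close>, divided by \<open>\<nu>\<close>. Passing from coordinates to the Euclidean
  norm costs the square root of the dimension, which the denominator of \<open>nu0_star\<close>
  later cancels.\<close>

lemma fd_gradient_error:
  fixes g :: "real ^ 'n \<Rightarrow> real"
  assumes \<nu>: "\<nu> > 0"
    and G: "\<And>z. z \<in> cball x \<nu> \<Longrightarrow> GDERIV g z :> G z"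
    and lip: "\<And>z. z \<in> cball x \<nu> \<Longrightarrow> norm (G z - G x) \<le> M * norm (z - x)"
  shows "norm (fd_gradient \<nu> g x - G x) \<le> sqrt (real CARD('n)) * (M * \<nu> / 2)"
proof -
  have comp: "\<bar>(fd_gradient \<nu> g x - G x) $ j\<bar> \<le> M * \<nu> / 2" for j
  proof -
    let ?y = "x + \<nu> *\<^sub>R axis j 1"
    have y: "norm (?y - x) = \<nu>"
      using \<nu> by simp
    have "closed_segment x ?y \<subseteq> cball x \<nu>"
      using \<nu> by (intro closed_segment_subset) (auto simp: dist_norm)
    then have "\<bar>g ?y - g x - G x \<bullet> (?y - x)\<bar> \<le> M / 2 * (norm (?y - x))\<^sup>2"
      by (intro descent_lemma G lip) auto
    then have "\<bar>g ?y - g x - \<nu> * G x $ j\<bar> \<le> (M * \<nu> / 2) * \<nu>"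
      unfolding y by (simp add: inner_axis power2_eq_square)
    moreover have "(fd_gradient \<nu> g x - G x) $ j = (g ?y - g x - \<nu> * G x $ j) / \<nu>"
      using \<nu> by (simp add: fd_gradient_nth field_simps)
    ultimately show ?thesis
      using \<nu> by (simp add: divide_le_eq)
  qed
  \<comment> \<open>The sign is read off from a coordinate bound, since an absolute value lies below
    this quantity.\<close>
  then have nonneg: "0 \<le> M * \<nu> / 2"
    using abs_ge_zero order_trans by blast
  have "norm (fd_gradient \<nu> g x - G x) \<le> L2_set (\<lambda>_. M * \<nu> / 2) (UNIV :: 'n set)"
    unfolding norm_vec_def using comp by (intro L2_set_mono) auto
  also have "\<dots> = sqrt (real CARD('n)) * (M * \<nu> / 2)"
    using nonneg by (subst L2_set_constant) auto
  finally show ?thesis .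
qed

section \<open>The safe radius around \<open>x0\<close>\<close>

lemma l0_star_pos:
  assumes "1 \<le> m" "\<And>i. i \<in> {1..m} \<Longrightarrow> 0 < L i" "strictly_feasible m f x0"
  shows "0 < l0_star m f L x0"
proof -
  have "0 < L_max m L"
    using assms(1,2) by (auto simp: L_max_def Max_gr_iff intro!: bexI[of _ 1])
  then show ?thesis
    using assms(1,3) by (auto simp: l0_star_def strictly_feasible_def divide_neg_pos)
qed

text \<open>Dividing the smallest slack by the largest Lipschitz constant makes one radius serve all
  constraints: over this distance no constraint can grow by more than its own slack.\<close>

lemma mult_l0_star_le:
  assumes "\<And>i. i \<in> {1..m} \<Longrightarrow> 0 < L i" "strictly_feasible m f x0" "i \<in> {1..m}"
  shows "L i * l0_star m f L x0 \<le> - f i x0"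
proof -
  have m: "1 \<le> m"
    using assms(3) by auto
  have Li: "0 < L i" "L i \<le> L_max m L"
    using assms(1,3) by (auto simp: L_max_def)
  have "L i * l0_star m f L x0 \<le> L_max m L * l0_star m f L x0"
    using Li l0_star_pos[of m L f x0, OF m assms(1,2)] by (intro mult_right_mono) auto
  also have "\<dots> \<le> L_max m L * (- f i x0 / L_max m L)"
    using Li assms(3) unfolding l0_star_def by (intro mult_left_mono Min_le) auto
  finally show ?thesis
    using Li by simp
qed

lemma ball_strictly_feasible:
  fixes f :: "nat \<Rightarrow> real ^ 'n \<Rightarrow> real"
  assumes cont: "\<And>i. i \<in> {1..m} \<Longrightarrow> continuous_on UNIV (f i)"
    and lip: "\<And>i. i \<in> {1..m} \<Longrightarrow> (L i)-lipschitz_on (feasible_set m f) (f i)"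
    and L: "\<And>i. i \<in> {1..m} \<Longrightarrow> 0 < L i"
    and x0: "strictly_feasible m f x0"
    and x: "x \<in> ball x0 (l0_star m f L x0)"
  shows "strictly_feasible m f x"
proof (rule segment_strictly_feasible[OF cont x0])
  fix t i
  let ?p = "x0 + t *\<^sub>R (x - x0)"
  assume t: "t \<in> {0..1::real}" and i: "i \<in> {1..m}"
    and "closed_segment x0 ?p \<subseteq> feasible_set m f"
  then have "dist (f i ?p) (f i x0) \<le> L i * dist ?p x0"
    by (intro lipschitz_onD[OF lip[OF i]]) auto
  then have "f i ?p \<le> f i x0 + L i * (t * norm (x - x0))"
    using t by (simp add: dist_norm abs_le_iff)
  also have "\<dots> \<le> f i x0 + L i * norm (x - x0)"
    using t L[OF i] by (simp add: mult_left_le_one_le)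
  also have "\<dots> < f i x0 + L i * l0_star m f L x0"
    using x L[OF i] by (simp add: dist_norm norm_minus_commute)
  also have "\<dots> \<le> 0"
    using mult_l0_star_le[of m L f x0 i, OF L x0 i] by simp
  finally show "f i ?p < 0" .
qed

text \<open>The closed ball is the closure of the open one, and the feasible set is closed. The
  boundary matters: in dimension one \<open>nu0_star\<close> equals \<open>l0_star\<close>, so the
  sample lies on it.\<close>

lemma cball_feasible:
  fixes f :: "nat \<Rightarrow> real ^ 'n \<Rightarrow> real"
  assumes m: "1 \<le> m"
    and cont: "\<And>i. i \<in> {1..m} \<Longrightarrow> continuous_on UNIV (f i)"
    and lip: "\<And>i. i \<in> {1..m} \<Longrightarrow> (L i)-lipschitz_on (feasible_set m f) (f i)"
    and L: "\<And>i. i \<in> {1..m} \<Longrightarrow> 0 < L i"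
    and x0: "strictly_feasible m f x0"
  shows "cball x0 (l0_star m f L x0) \<subseteq> feasible_set m f"
proof -
  have "feasible_set m f = (\<Inter>i\<in>{1..m}. {x. f i x \<le> 0})"
    by (auto simp: feasible_set_def)
  moreover have "closed \<dots>"
    using cont by (intro closed_INT ballI closed_Collect_le) auto
  ultimately have "closed (feasible_set m f)"
    by simp
  moreover have "ball x0 (l0_star m f L x0) \<subseteq> feasible_set m f"
    using ball_strictly_feasible[OF cont lip L x0]
    by (auto simp: strictly_feasible_def feasible_set_def less_imp_le)
  moreover have "closure (ball x0 (l0_star m f L x0)) = cball x0 (l0_star m f L x0)"
    using l0_star_pos[OF m L x0] by (rule closure_ball)
  ultimately show ?thesis
    using closure_minimal by metis
qed

section \<open>Feasibility of the samples and safety of the local set\<close>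

theorem theorem1:
  fixes m :: nat
    and f :: "nat \<Rightarrow> real ^ 'n \<Rightarrow> real"
    and L M :: "nat \<Rightarrow> real"
    and \<Omega>bar :: "(real ^ 'n) set"
    and x0 :: "real ^ 'n"
  assumes m: "1 \<le> m"
    and C1: "\<And>i. i \<in> {0..m} \<Longrightarrow> continuously_differentiable (f i)"
    and pos: "\<And>i. i \<in> {0..m} \<Longrightarrow> 0 < L i \<and> 0 < M i"
    and sub: "feasible_set m f \<subseteq> \<Omega>bar"
    and lipschitz: "\<And>i. i \<in> {0..m} \<Longrightarrow> (L i)-lipschitz_on \<Omega>bar (f i)"
    and smooth: "\<And>i. i \<in> {0..m} \<Longrightarrow> (M i)-lipschitz_on \<Omega>bar (gradient (f i))"
    and L_inf: "\<And>i. i \<in> {0..m} \<Longrightarrow> lipschitz_inf (feasible_set m f) (f i) < L i"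
    and M_inf: "\<And>i. i \<in> {0..m} \<Longrightarrow> lipschitz_inf (feasible_set m f) (gradient (f i)) < M i"
    and x0: "strictly_feasible m f x0"
  shows "(x0 \<in> feasible_set m f \<and>
          (\<forall>j. x0 + nu0_star m f L x0 *\<^sub>R axis j 1 \<in> feasible_set m f)) \<and>
         (x0 \<in> local_set m f L M x0 \<and> local_set m f L M x0 \<noteq> {}) \<and>
         (\<forall>x \<in> local_set m f L M x0. strictly_feasible m f x)"
proof (intro conjI allI ballI)
  define l where "l = l0_star m f L x0"
  define \<nu> where "\<nu> = nu0_star m f L x0"
  have diff: "f i differentiable at z" if "i \<in> {1..m}" for i z
    using C1[of i] that by (auto simp: continuously_differentiable_def)
  then have cont: "continuous_on UNIV (f i)" if "i \<in> {1..m}" for i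
    using that by (auto simp: continuous_on_eq_continuous_at intro: differentiable_imp_continuous_within)
  have lip: "(L i)-lipschitz_on (feasible_set m f) (f i)"
    and lipG: "(M i)-lipschitz_on (feasible_set m f) (gradient (f i))" if "i \<in> {1..m}" for i
    using lipschitz[of i] smooth[of i] that sub by (auto intro: lipschitz_on_subset)
  have L: "0 < L i" and M: "0 < M i" if "i \<in> {1..m}" for i
    using pos[of i] that by auto
  have l: "l > 0"
    unfolding l_def using l0_star_pos[OF m L x0] .
  have \<nu>_eq: "\<nu> = l / sqrt (real CARD('n))"
    by (simp add: \<nu>_def nu0_star_def l_def)
  then have \<nu>: "0 < \<nu>" "\<nu> \<le> l"
    using l by (auto simp: divide_le_eq Suc_leI)
  have cball: "cball x0 l \<subseteq> feasible_set m f"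
    unfolding l_def using cball_feasible[OF m cont lip L x0] .
  show x0_feas: "x0 \<in> feasible_set m f"
    using cball l by auto
  show "x0 + nu0_star m f L x0 *\<^sub>R axis j 1 \<in> feasible_set m f" for j
    using cball \<nu> by (auto simp: subset_iff dist_norm simp flip: \<nu>_def)
  show "x0 \<in> local_set m f L M x0"
    using x0 by (auto simp: local_set_def local_set_i_def strictly_feasible_def less_imp_le)
  then show "local_set m f L M x0 \<noteq> {}"
    by blast
  show "strictly_feasible m f x" if x: "x \<in> local_set m f L M x0" for x
  proof (cases "norm (x - x0) < l")
    case True
    then show ?thesis
      using ball_strictly_feasible[OF cont lip L x0, of x]
      by (simp add: l_def dist_norm norm_minus_commute)
  next
    case False
    define r where "r = norm (x - x0)"
    have r: "l \<le> r" "0 < r"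
      using False l by (auto simp: r_def)
    show ?thesis
    proof (rule segment_strictly_feasible[OF cont x0])
      fix t i
      let ?p = "x0 + t *\<^sub>R (x - x0)"
      assume t: "t \<in> {0..1::real}" and i: "i \<in> {1..m}"
        and seg: "closed_segment x0 ?p \<subseteq> feasible_set m f"
      let ?G = "gradient (f i)" and ?D = "fd_gradient \<nu> (f i) x0"
      have G: "GDERIV (f i) z :> ?G z" for z
        using diff[OF i] by (rule gradient_GDERIV)
      have GL: "norm (?G z - ?G x0) \<le> M i * norm (z - x0)" if "z \<in> feasible_set m f" for z
        using lipschitz_onD[OF lipG[OF i] that x0_feas] by (simp add: dist_norm)
      have "norm (?D - ?G x0) \<le> sqrt (real CARD('n)) * (M i * \<nu> / 2)"
        using \<nu> cball by (intro fd_gradient_error G GL) auto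
      \<comment> \<open>The choice of \<open>\<nu>\<close> cancels the dimension factor.\<close>
      also have "\<dots> = M i * l / 2"
        by (simp add: \<nu>_eq)
      also have "\<dots> \<le> M i * r / 2"
        using r M[OF i] by simp
      finally have err: "norm (?D - ?G x0) \<le> M i * r / 2" .
      have "(?G x0 - ?D) \<bullet> (x - x0) \<le> norm (?G x0 - ?D) * r"
        unfolding r_def by (rule norm_cauchy_schwarz)
      also have "\<dots> \<le> (M i * r / 2) * r"
        using err r by (intro mult_right_mono) (auto simp: norm_minus_commute)
      finally have slope: "?G x0 \<bullet> (x - x0) \<le> ?D \<bullet> (x - x0) + M i / 2 * r\<^sup>2"
        by (simp add: inner_diff_left power2_eq_square)
      have "?D \<bullet> (x - x0) \<le> - f i x0 - 2 * M i * r\<^sup>2"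
        using x i by (force simp: local_set_def local_set_i_def \<nu>_def r_def)
      \<comment> \<open>Of the coefficient 2 in the local set, 1/2 pays for the finite-difference
        error, leaving 3/2. The Taylor remainder below takes another 1/2.\<close>
      with slope have slope: "?G x0 \<bullet> (x - x0) \<le> - f i x0 - 3 / 2 * M i * r\<^sup>2"
        by simp
      have "f i ?p - f i x0 - ?G x0 \<bullet> (?p - x0) \<le> M i / 2 * (norm (?p - x0))\<^sup>2"
        using seg by (intro descent_lemma_upper G GL) auto
      then have "f i ?p \<le> f i x0 + t * (?G x0 \<bullet> (x - x0)) + M i / 2 * (t\<^sup>2 * r\<^sup>2)"
        by (simp add: r_def power_mult_distrib)
      \<comment> \<open>Weakening \<open>t\<^sup>2\<close> to \<open>t\<close> lets the remainder be
        absorbed by the linear term at every time, not only at \<open>t = 1\<close>.\<close>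
      also have "\<dots> \<le> f i x0 + t * (- f i x0 - 3 / 2 * M i * r\<^sup>2) + M i / 2 * (t * r\<^sup>2)"
      proof -
        have "t\<^sup>2 \<le> t"
          using t by (simp add: power2_eq_square mult_left_le_one_le)
        then have "M i / 2 * (t\<^sup>2 * r\<^sup>2) \<le> M i / 2 * (t * r\<^sup>2)"
          using M[OF i] by (intro mult_left_mono mult_right_mono) auto
        moreover have "t * (?G x0 \<bullet> (x - x0)) \<le> t * (- f i x0 - 3 / 2 * M i * r\<^sup>2)"
          using slope t by (intro mult_left_mono) auto
        ultimately show ?thesis
          by simp
      qed
      also have "\<dots> = (1 - t) * f i x0 - t * (M i * r\<^sup>2)"
        by (simp add: algebra_simps)
      also have "\<dots> < 0"
      \<comment> \<open>Neither term is strictly negative on all of \<open>{0..1}\<close>: the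
        quadratic one vanishes at 0, the one with \<open>f i x0\<close> at 1.\<close>
      proof (cases "t = 0")
        case True
        then show ?thesis
          using x0 i by (simp add: strictly_feasible_def)
      next
        case False
        then have "0 < t * (M i * r\<^sup>2)"
          using t M[OF i] r by simp
        moreover have "(1 - t) * f i x0 \<le> 0"
          using t x0 i by (auto simp: strictly_feasible_def mult_nonneg_nonpos less_imp_le)
        ultimately show ?thesis
          by simp
      qed
      finally show "f i ?p < 0" .
    qed
  qed
qed

end
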